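(* Let $(X,\|\cdot\|)$ be a real normed vector space and let $\{\vec{x},\vec{y}\}\subset X$ be linearly independent. Then the map $$\Theta:\mathbb{R}\longrightarrow(0,\pi),\qquad t\mapsto \angle_{Thy}(\vec{x},\,\vec{y}+t\cdot\vec{x})$$ is a decreasing homeomorphism from $\mathbb{R}$ onto $(0,\pi)$.
   Context: For a real normed vector space $(X,\|\cdot\|)$ and $\vec{x},\vec{y}\in X\setminus\{\vec{0}\}$, the Thy angle is $$\angle_{Thy}(\vec{x},\vec{y}):=\arccos\left(\frac14\left[\left\|\frac{\vec{x}}{\|\vec{x}\|}+\frac{\vec{y}}{\|\vec{y}\|}\right\|^2-\left\|\frac{\vec{x}}{\|\vec{x}\|}-\frac{\vec{y}}{\|\vec{y}\|}\right\|^2\right]\right)\in[0,\pi].$$ By the triangle inequality the argument of $\arccos$ lies in $[-1,1]$, so the angle is defined. *)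

theory Defs
  imports "HOL-Analysis.Analysis"
begin

(* Only meaningful for nonzero arguments. For those, the argument of arccos lies in
   the interval [-1, 1] by the triangle inequality, so the value lies in [0, pi]. *)
definition thy_angle :: "'a::real_normed_vector \<Rightarrow> 'a \<Rightarrow> real" where
  "thy_angle x y =
     arccos (1 / 4 * ((norm (x /\<^sub>R norm x + y /\<^sub>R norm y))\<^sup>2
                    - (norm (x /\<^sub>R norm x - y /\<^sub>R norm y))\<^sup>2))"

end

theory Submission
  imports Defs
begin

text \<open>
  Fix the unit vector \<open>u\<close> in the direction of \<open>x\<close>. As \<open>t\<close> grows, the unit vector
  \<open>v\<close> in the direction of \<open>y + t x\<close> runs along the half of the unit circle of the
  plane spanned by \<open>x\<close> and \<open>y\<close> that leads from \<open>- u\<close> to \<open>u\<close>. The classical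
  monotonicity of distances on a normed circle (in a quadrilateral, the diagonals together
  are at least as long as two opposite sides) says that on the way \<open>norm (u - v)\<close>
  does not increase and \<open>norm (u + v)\<close> does not decrease, so the argument of \<open>arccos\<close>
  does not decrease.

  If the norm is not strictly convex, either of the two distances may stay constant on an arc.
  Both cannot be constant at once: by the equality cases of the two triangle inequalities, two
  points \<open>w\<close> and \<open>v\<close> with the same pair of distances satisfy
  \<open>norm (u + w) + norm (u - w) = 2 = norm ((u + w) + (u - w))\<close>. Then the norm is additive
  on the cone spanned by \<open>u + w\<close> and \<open>u - w\<close>. The vector \<open>u + v\<close> lies in this
  cone, and additivity gives \<open>norm (u + v) > norm (u + w)\<close>, a contradiction. This is
  \<open>thy_cos_strict\<close>, and it yields that the angle decreases strictly.

  The rest is soft. The direction of \<open>y + t x\<close> tends to \<open>u\<close> as \<open>t\<close> tends to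
  infinity, so the angle tends to \<open>0\<close> there; the symmetry
  \<open>angle x (- y) = pi - angle x y\<close> turns this into the limit \<open>pi\<close> at minus
  infinity. By the intermediate value theorem the image is the whole open interval, and a
  continuous injection of the line into the line is a homeomorphism onto its image.
\<close>

section \<open>Distances on the unit circle of a normed plane\<close>

text \<open>
  For a norm that comes from an inner product, this is the inner product, by polarization.
\<close>

definition thy_cos :: "'a::real_normed_vector \<Rightarrow> 'a \<Rightarrow> real" where
  "thy_cos u v = 1 / 4 * ((norm (u + v))\<^sup>2 - (norm (u - v))\<^sup>2)"

lemma thy_angle_eq: "thy_angle x y = arccos (thy_cos (x /\<^sub>R norm x) (y /\<^sub>R norm y))"
  by (simp add: thy_angle_def thy_cos_def)

lemma thy_cos_minus_right: "thy_cos u (- v) = - thy_cos u v"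
  by (simp add: thy_cos_def field_simps)

lemma thy_cos_self:
  assumes "norm u = 1"
  shows "thy_cos u u = 1"
proof -
  have "norm (u + u) = 2"
    using assms by (simp flip: scaleR_2)
  then show ?thesis
    by (simp add: thy_cos_def)
qed

lemma abs_thy_cos_le_1:
  assumes "norm u = 1" "norm v = 1"
  shows "\<bar>thy_cos u v\<bar> \<le> 1"
proof -
  have "norm (u + v) \<le> 2" "norm (u - v) \<le> 2"
    using norm_triangle_ineq[of u v] norm_triangle_ineq4[of u v] assms by auto
  then have "(norm (u + v))\<^sup>2 \<le> 4" "(norm (u - v))\<^sup>2 \<le> 4"
    using power_mono[of "norm (u + v)" 2 2] power_mono[of "norm (u - v)" 2 2] by simp_all
  moreover have "\<bar>1 / 4 * (p - q)\<bar> \<le> 1" if "0 \<le> p" "p \<le> 4" "0 \<le> q" "q \<le> 4" for p q :: real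
    using that by (simp add: abs_le_iff)
  ultimately show ?thesis
    unfolding thy_cos_def by (meson zero_le_power2)
qed

text \<open>
  The point \<open>v / (a + b)\<close> lies both on the segment from \<open>0\<close> to \<open>v\<close> and on the one from
  \<open>u\<close> to \<open>w\<close>, so these are the diagonals of a quadrilateral with opposite sides
  \<open>norm (u - v)\<close> and \<open>norm w = 1\<close>. The claim is the sum of the two triangle
  inequalities at the crossing point, scaled by \<open>a + b\<close>; equality forces equality in both.
\<close>

lemma norm_diff_unit_between:
  fixes u v w :: "'a::real_normed_vector"
  assumes unit: "norm u = 1" "norm v = 1" "norm w = 1"
    and v: "v = a *\<^sub>R u + b *\<^sub>R w" and ab: "a > 0" "b > 0"
  shows "norm (u - v) \<le> norm (u - w)"
    and "norm (u - v) = norm (u - w) \<Longrightarrow> a * norm (u - w) = a + b - 1"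
proof -
  have ge1: "1 \<le> a + b"
    using norm_triangle_ineq[of "a *\<^sub>R u" "b *\<^sub>R w"] unit v ab by simp
  have "(a + b) *\<^sub>R (u - v) = b *\<^sub>R (u - w) - (a + b - 1) *\<^sub>R v"
    by (simp add: v algebra_simps)
  then have "norm ((a + b) *\<^sub>R (u - v)) \<le> norm (b *\<^sub>R (u - w)) + norm ((a + b - 1) *\<^sub>R v)"
    by (metis norm_triangle_ineq4)
  then have 1: "(a + b) * norm (u - v) \<le> b * norm (u - w) + (a + b - 1)"
    using ab ge1 unit by simp
  have "(a + b) *\<^sub>R w = v - a *\<^sub>R (u - w)"
    by (simp add: v algebra_simps)
  then have "norm ((a + b) *\<^sub>R w) \<le> norm v + norm (a *\<^sub>R (u - w))"
    by (metis norm_triangle_ineq4)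
  then have 2: "a + b - 1 \<le> a * norm (u - w)"
    using ab unit by simp
  have "(a + b) * norm (u - v) \<le> (a + b) * norm (u - w)"
    using 1 2 by (simp add: algebra_simps)
  then show "norm (u - v) \<le> norm (u - w)"
    using ab by simp
  show "a * norm (u - w) = a + b - 1" if "norm (u - v) = norm (u - w)"
    using 1 2 that by (simp add: algebra_simps)
qed

text \<open>
  Additivity at one pair extends to the cone: a strictly shorter \<open>a p + b q\<close> with \<open>b \<le> a\<close>
  could be completed by \<open>(a - b) q\<close> to a path to \<open>a (p + q)\<close> that is shorter than the norm
  of its end point.
\<close>

lemma norm_add_eq_imp_additive_on_cone:
  fixes p q :: "'a::real_normed_vector"
  assumes eq: "norm (p + q) = norm p + norm q" and "0 \<le> a" "0 \<le> b"
  shows "norm (a *\<^sub>R p + b *\<^sub>R q) = a * norm p + b * norm q"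
proof -
  have *: "d * norm r + c * norm s \<le> norm (d *\<^sub>R r + c *\<^sub>R s)"
    if "norm (r + s) = norm r + norm s" "0 \<le> c" "c \<le> d" for c d and r s :: 'a
  proof -
    have "d *\<^sub>R (r + s) = (d *\<^sub>R r + c *\<^sub>R s) + (d - c) *\<^sub>R s"
      by (simp add: algebra_simps)
    then have "norm (d *\<^sub>R (r + s)) \<le> norm (d *\<^sub>R r + c *\<^sub>R s) + norm ((d - c) *\<^sub>R s)"
      by (metis norm_triangle_ineq)
    moreover have "norm (d *\<^sub>R (r + s)) = d * (norm r + norm s)"
      "norm ((d - c) *\<^sub>R s) = (d - c) * norm s"
      using that by simp_all
    ultimately show ?thesis
      by (simp add: algebra_simps)
  qed
  have "a * norm p + b * norm q \<le> norm (a *\<^sub>R p + b *\<^sub>R q)"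
    using *[of p q b a] *[of q p a b] assms by (cases "b \<le> a") (auto simp: add.commute)
  moreover have "norm (a *\<^sub>R p + b *\<^sub>R q) \<le> a * norm p + b * norm q"
    using norm_triangle_ineq[of "a *\<^sub>R p" "b *\<^sub>R q"] assms by simp
  ultimately show ?thesis
    by simp
qed

text \<open>
  Here \<open>v\<close> lies strictly between \<open>w\<close> and \<open>u\<close>, hence \<open>w\<close> strictly between \<open>v\<close> and
  \<open>- u\<close>. Monotonicity of the distance, used once for \<open>u\<close> and once for \<open>- u\<close>, compares
  both distances; if both were unchanged, their equality cases would add up to
  \<open>norm (u + w) + norm (u - w) = 2\<close>, and the norm would be additive on a cone that
  contains \<open>u + v\<close>.
\<close>

lemma thy_cos_strict:
  fixes u v w :: "'a::real_normed_vector"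
  assumes unit: "norm u = 1" "norm v = 1" "norm w = 1"
    and v: "v = a *\<^sub>R u + b *\<^sub>R w" and ab: "a > 0" "b > 0"
    and neq: "w \<noteq> u" "w \<noteq> - u"
  shows "thy_cos u w < thy_cos u v"
proof -
  have w: "w = (a / b) *\<^sub>R (- u) + (1 / b) *\<^sub>R v"
    using ab by (simp add: v algebra_simps)
  note minus = norm_diff_unit_between[OF unit v ab]
  have unit': "norm (- u) = 1" and ab': "a / b > 0" "1 / b > 0"
    using unit ab by simp_all
  have swap: "norm (- u - z) = norm (u + z)" for z
    by (metis minus_diff_commute norm_minus_commute diff_minus_eq_add add.commute)
  note plus = norm_diff_unit_between[OF unit' unit(3) unit(2) w ab', unfolded swap]
  have "norm (u - v) \<noteq> norm (u - w) \<or> norm (u + v) \<noteq> norm (u + w)"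
  proof (rule ccontr)
    assume "\<not> ?thesis"
    then have same: "norm (u - v) = norm (u - w)" "norm (u + w) = norm (u + v)"
      by auto
    define d where "d = norm (u - w)"
    define e where "e = norm (u + w)"
    have d: "a * d = a + b - 1"
      using minus(2) same by (simp add: d_def)
    have "(a / b) * e = a / b + 1 / b - 1"
      using plus(2) same by (simp add: e_def)
    then have e: "a * e = a + 1 - b"
      using ab by (simp add: field_simps)
    have "a * (d + e) = a * 2"
      using d e by (simp add: algebra_simps)
    then have sum: "d + e = 2"
      using ab by simp
    have pos: "d > 0" "e > 0"
      using neq by (auto simp: d_def e_def eq_neg_iff_add_eq_0 add.commute)
    have "(u + w) + (u - w) = 2 *\<^sub>R u"
      by (simp add: scaleR_2)
    then have "norm ((u + w) + (u - w)) = norm (u + w) + norm (u - w)"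
      using sum unit by (simp add: d_def e_def)
    then have additive: "norm ((1 + a * d / 2) *\<^sub>R (u + w) + (a * e / 2) *\<^sub>R (u - w))
        = (1 + a * d / 2) * norm (u + w) + (a * e / 2) * norm (u - w)"
      using ab pos by (intro norm_add_eq_imp_additive_on_cone) auto
    \<comment> \<open>In terms of \<open>u + w\<close> and \<open>u - w\<close>, the vector \<open>u + v\<close> has the coefficients
      \<open>(1 + a + b) / 2\<close> and \<open>(1 + a - b) / 2\<close>; the formulas for \<open>a * d\<close> and \<open>a * e\<close>
      show them to be positive.\<close>
    have "(1 + a * d / 2) + a * e / 2 = 1 + a" "(1 + a * d / 2) - a * e / 2 = b"
      unfolding d e by (simp_all add: field_simps)
    moreover have "k *\<^sub>R (u + w) + l *\<^sub>R (u - w) = (k + l) *\<^sub>R u + (k - l) *\<^sub>R w" for k l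
      by (simp add: algebra_simps)
    moreover have "u + v = (1 + a) *\<^sub>R u + b *\<^sub>R w"
      by (simp add: v algebra_simps)
    ultimately have "(1 + a * d / 2) *\<^sub>R (u + w) + (a * e / 2) *\<^sub>R (u - w) = u + v"
      by metis
    with additive have "e = (1 + a * d / 2) * e + (a * e / 2) * d"
      using same by (simp add: d_def e_def)
    then have "a * d * e = 0"
      by (simp add: algebra_simps)
    then show False
      using ab pos by simp
  qed
  then have "norm (u - v) < norm (u - w) \<or> norm (u + w) < norm (u + v)"
    using minus(1) plus(1) by fastforce
  then have squares: "(norm (u - v))\<^sup>2 < (norm (u - w))\<^sup>2 \<or> (norm (u + w))\<^sup>2 < (norm (u + v))\<^sup>2"
    by (meson norm_ge_zero power_strict_mono zero_less_numeral)
  have "1 / 4 * (p - q) < 1 / 4 * (p' - q')" if "p \<le> p'" "q' \<le> q" "q' < q \<or> p < p'"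
    for p q p' q' :: real
    using that by auto
  then show ?thesis
    unfolding thy_cos_def using squares minus(1) plus(1) by (meson norm_ge_zero power_mono)
qed

section \<open>The angle along a line parallel to \<open>x\<close>\<close>

lemma thy_angle_minus_right:
  assumes "x \<noteq> 0" "y \<noteq> 0"
  shows "thy_angle x (- y) = pi - thy_angle x y"
  using abs_thy_cos_le_1[of "x /\<^sub>R norm x" "y /\<^sub>R norm y"] assms
  by (simp add: thy_angle_eq thy_cos_minus_right abs_le_iff arccos_minus)

lemma independent_pair_not_multiple:
  assumes "x \<noteq> y" "independent {x, y}"
  shows "x \<noteq> 0" "y + t *\<^sub>R x \<noteq> c *\<^sub>R x"
proof -
  show "x \<noteq> 0"
    using assms dependent_zero by blast
  show "y + t *\<^sub>R x \<noteq> c *\<^sub>R x"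
  proof
    assume "y + t *\<^sub>R x = c *\<^sub>R x"
    then have "y = (c - t) *\<^sub>R x"
      by (simp add: algebra_simps)
    then have "y \<in> span {x}"
      by (simp add: span_base span_scale)
    moreover have "y \<notin> span ({x, y} - {y})"
      using assms(2) unfolding dependent_def by blast
    ultimately show False
      using assms(1) by (simp add: insert_Diff_if)
  qed
qed

text \<open>
  Since \<open>y + t x\<close> arises from \<open>y + s x\<close> by adding a positive multiple of \<open>x\<close>, its direction
  lies strictly between that of \<open>y + s x\<close> and that of \<open>x\<close>.
\<close>

lemma thy_angle_line_strict_antimono:
  assumes x: "x \<noteq> 0" and not_mult: "\<And>c t. y + t *\<^sub>R x \<noteq> c *\<^sub>R x" and "s < t"
  shows "thy_angle x (y + t *\<^sub>R x) < thy_angle x (y + s *\<^sub>R x)"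
proof -
  define u where "u = x /\<^sub>R norm x"
  define dir where "dir r = (y + r *\<^sub>R x) /\<^sub>R norm (y + r *\<^sub>R x)" for r
  have nz: "y + r *\<^sub>R x \<noteq> 0" for r
    using not_mult[of r 0] by simp
  have unit: "norm u = 1" "norm (dir r) = 1" for r
    using x nz by (simp_all add: u_def dir_def)
  have scale: "y + r *\<^sub>R x = norm (y + r *\<^sub>R x) *\<^sub>R dir r" for r
    using nz by (simp add: dir_def)
  have neq: "dir s \<noteq> k *\<^sub>R u" for k
    using scale[of s] not_mult[of s] by (metis u_def scaleR_scaleR)
  define a where "a = (t - s) * norm x / norm (y + t *\<^sub>R x)"
  define b where "b = norm (y + s *\<^sub>R x) / norm (y + t *\<^sub>R x)"
  have "norm (y + t *\<^sub>R x) *\<^sub>R dir t = (y + s *\<^sub>R x) + (t - s) *\<^sub>R x"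
    by (simp add: scale[of t, symmetric] algebra_simps)
  also have "\<dots> = norm (y + s *\<^sub>R x) *\<^sub>R dir s + ((t - s) * norm x) *\<^sub>R u"
    using x by (simp add: scale[of s, symmetric] u_def)
  also have "\<dots> = norm (y + t *\<^sub>R x) *\<^sub>R (a *\<^sub>R u + b *\<^sub>R dir s)"
    using nz[of t] by (simp add: a_def b_def scaleR_add_right)
  finally have "dir t = a *\<^sub>R u + b *\<^sub>R dir s"
    using nz[of t] by simp
  moreover have "a > 0" "b > 0"
    using \<open>s < t\<close> x nz by (simp_all add: a_def b_def)
  moreover have "dir s \<noteq> u" "dir s \<noteq> - u"
    using neq[of 1] neq[of "-1"] by simp_all
  ultimately have "thy_cos u (dir s) < thy_cos u (dir t)"
    by (intro thy_cos_strict[of u "dir t" "dir s" a b] unit)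
  then have "arccos (thy_cos u (dir t)) < arccos (thy_cos u (dir s))"
    by (subst arccos_less_mono) (auto intro: abs_thy_cos_le_1 unit)
  then show ?thesis
    by (simp add: thy_angle_eq u_def dir_def)
qed

lemma continuous_thy_angle_line:
  assumes "x \<noteq> 0" "\<And>t. y + t *\<^sub>R x \<noteq> 0"
  shows "continuous_on UNIV (\<lambda>t. thy_angle x (y + t *\<^sub>R x))"
proof -
  have "continuous_on UNIV
      (\<lambda>t. thy_cos (x /\<^sub>R norm x) ((y + t *\<^sub>R x) /\<^sub>R norm (y + t *\<^sub>R x)))"
    unfolding thy_cos_def using assms by (intro continuous_intros) auto
  moreover have "\<bar>thy_cos (x /\<^sub>R norm x) ((y + t *\<^sub>R x) /\<^sub>R norm (y + t *\<^sub>R x))\<bar> \<le> 1" for t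
    using assms by (intro abs_thy_cos_le_1) auto
  ultimately show ?thesis
    unfolding thy_angle_eq by (intro continuous_on_arccos) (auto simp: abs_le_iff)
qed

text \<open>
  For \<open>t > 0\<close> the vector \<open>y + t x\<close> has the direction of \<open>y / t + x\<close>, which tends to \<open>x\<close>.
\<close>

lemma thy_angle_line_tendsto_0:
  assumes x: "x \<noteq> 0" and nz: "\<And>t. y + t *\<^sub>R x \<noteq> 0"
  shows "((\<lambda>t. thy_angle x (y + t *\<^sub>R x)) \<longlongrightarrow> 0) at_top"
proof -
  define u where "u = x /\<^sub>R norm x"
  define dir where "dir t = (y + t *\<^sub>R x) /\<^sub>R norm (y + t *\<^sub>R x)" for t
  have unit: "norm u = 1" "norm (dir t) = 1" for t
    using x nz by (simp_all add: u_def dir_def)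
  have "((\<lambda>t::real. inverse t *\<^sub>R y + x) \<longlongrightarrow> 0 *\<^sub>R y + x) at_top"
    by (intro tendsto_intros tendsto_inverse_0_at_top filterlim_ident)
  then have "((\<lambda>t. (inverse t *\<^sub>R y + x) /\<^sub>R norm (inverse t *\<^sub>R y + x)) \<longlongrightarrow> u) at_top"
    unfolding u_def using x by (intro tendsto_intros) auto
  moreover have "eventually (\<lambda>t. (inverse t *\<^sub>R y + x) /\<^sub>R norm (inverse t *\<^sub>R y + x) = dir t) at_top"
    using eventually_gt_at_top[of 0]
  proof eventually_elim
    case (elim t)
    have "y + t *\<^sub>R x = t *\<^sub>R (inverse t *\<^sub>R y + x)"
      using elim by (simp add: scaleR_add_right)
    then show ?case
      using elim by (simp add: dir_def)
  qed
  ultimately have dir: "(dir \<longlongrightarrow> u) at_top"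
    by (rule Lim_transform_eventually)
  have "((\<lambda>t. thy_cos u (dir t)) \<longlongrightarrow> thy_cos u u) at_top"
    unfolding thy_cos_def by (intro tendsto_intros dir)
  then have "((\<lambda>t. arccos (thy_cos u (dir t))) \<longlongrightarrow> arccos 1) at_top"
    using abs_thy_cos_le_1[OF unit] thy_cos_self[OF unit(1)]
    by (intro continuous_on_tendsto_compose[OF continuous_on_arccos']) (auto simp: abs_le_iff)
  then show ?thesis
    by (simp add: thy_angle_eq u_def dir_def)
qed

text \<open>
  The vector \<open>y - t x\<close> is the negative of \<open>- y + t x\<close>, so this is the preceding limit for
  \<open>- y\<close> in place of \<open>y\<close>.
\<close>

lemma thy_angle_line_tendsto_pi:
  assumes x: "x \<noteq> 0" and nz: "\<And>t. y + t *\<^sub>R x \<noteq> 0"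
  shows "((\<lambda>t. thy_angle x (y + t *\<^sub>R x)) \<longlongrightarrow> pi) at_bot"
proof -
  have reflect: "- (y + t *\<^sub>R x) = - y + (- t) *\<^sub>R x" for t
    by simp
  have nz': "- y + t *\<^sub>R x \<noteq> 0" for t
    using nz[of "- t"] reflect[of "- t"] by (metis minus_minus neg_equal_0_iff_equal)
  have "((\<lambda>t. pi - thy_angle x (- y + t *\<^sub>R x)) \<longlongrightarrow> pi - 0) at_top"
    by (intro tendsto_intros thy_angle_line_tendsto_0 x nz')
  moreover have "pi - thy_angle x (- y + t *\<^sub>R x) = thy_angle x (y + (- t) *\<^sub>R x)" for t
    using thy_angle_minus_right[OF x nz'[of t]] by simp
  ultimately show ?thesis
    by (simp add: filterlim_at_bot_mirror)
qed

text \<open>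
  A limit is never attained by a strictly decreasing function, which excludes the end points;
  every value strictly between the limits is attained by the intermediate value theorem.
\<close>

lemma strict_antimono_continuous_range:
  fixes f :: "real \<Rightarrow> real"
  assumes cont: "continuous_on UNIV f" and anti: "strict_antimono_on UNIV f"
    and top: "(f \<longlongrightarrow> l) at_top" and bot: "(f \<longlongrightarrow> m) at_bot"
  shows "range f = {l<..<m}"
proof
  have less: "f t < f s" if "s < t" for s t
    using anti that by (simp add: monotone_on_def)
  show "range f \<subseteq> {l<..<m}"
  proof clarify
    fix t
    have "l \<le> f (t + 1)"
      using top by (rule tendsto_upperbound)
        (auto intro: eventually_mono[OF eventually_gt_at_top[of "t + 1"]] less less_imp_le)
    moreover have "f (t - 1) \<le> m"
      using bot by (rule tendsto_lowerbound)
        (auto intro: eventually_mono[OF eventually_gt_at_bot[of "t - 1"]] less less_imp_le)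
    ultimately show "f t \<in> {l<..<m}"
      using less[of t "t + 1"] less[of "t - 1" t] by simp
  qed
  show "{l<..<m} \<subseteq> range f"
  proof
    fix c assume "c \<in> {l<..<m}"
    then have "eventually (\<lambda>t. f t < c) at_top" "eventually (\<lambda>t. c < f t) at_bot"
      using order_tendstoD[OF top] order_tendstoD[OF bot] by auto
    then obtain t s where "f t < c" "c < f s"
      by (metis eventually_happens trivial_limit_at_top_linorder trivial_limit_at_bot_linorder)
    moreover have "connected (range f)"
      using cont connected_UNIV by (rule connected_continuous_image)
    ultimately show "c \<in> range f"
      by (meson connectedD_interval less_imp_le rangeI)
  qed
qed

theorem theorem1:
  fixes x y :: "'a::real_normed_vector"
  assumes "x \<noteq> y" and "independent {x, y}"
  shows "strict_antimono_on UNIV (\<lambda>t::real. thy_angle x (y + t *\<^sub>R x)) \<and>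
         (\<exists>g. homeomorphism UNIV {0<..<pi} (\<lambda>t::real. thy_angle x (y + t *\<^sub>R x)) g)"
proof -
  let ?f = "\<lambda>t::real. thy_angle x (y + t *\<^sub>R x)"
  have x: "x \<noteq> 0" and not_mult: "y + t *\<^sub>R x \<noteq> c *\<^sub>R x" for c t
    using independent_pair_not_multiple[OF assms] by auto
  then have nz: "y + t *\<^sub>R x \<noteq> 0" for t
    using not_mult[of t 0] by simp
  have anti: "strict_antimono_on UNIV ?f"
    using thy_angle_line_strict_antimono[OF x not_mult] by (auto simp: monotone_on_def)
  have cont: "continuous_on UNIV ?f"
    using x nz by (rule continuous_thy_angle_line)
  have range: "range ?f = {0<..<pi}"
    using cont anti thy_angle_line_tendsto_0[OF x nz] thy_angle_line_tendsto_pi[OF x nz]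
    by (rule strict_antimono_continuous_range)
  have "inj ?f"
    using anti strict_antimono_iff_antimono by blast
  then have "\<exists>g. homeomorphism UNIV {0<..<pi} ?f g"
    using cont range by (intro homeomorphism_into_1d) auto
  with anti show ?thesis
    by blast
qed

end
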